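(* Let $P=(V,\preceq)$ be a poset of finite width with $V\subseteq\mathbb{R}$ such that $x\preceq y$ implies $x\leqslant y$ for all $x,y\in V$. Then every maximal chain $Y$ in $P$ contains a countable chain $X$ such that $Y$ is the only maximal chain of $P$ containing $X$.
   Context: The width of a poset is the maximum size of an antichain. A chain is a set of pairwise comparable elements; a maximal chain is a chain not properly contained in another chain. *)

theory Defs
  imports Complex_Main "HOL-Library.Countable_Set"
begin

definition antichain_on :: "'a set \<Rightarrow> 'a rel \<Rightarrow> 'a set \<Rightarrow> bool" where
  "antichain_on V r A \<longleftrightarrow> A \<subseteq> V \<and> (\<forall>x\<in>A. \<forall>y\<in>A. x \<noteq> y \<longrightarrow> (x, y) \<notin> r)"

text \<open>
  The maximum is attained and the finiteness of all antichains is explicit,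
  since \<open>card\<close> is 0 on infinite sets.
\<close>

definition has_width :: "'a set \<Rightarrow> 'a rel \<Rightarrow> nat \<Rightarrow> bool" where
  "has_width V r w \<longleftrightarrow>
     (\<exists>A. antichain_on V r A \<and> finite A \<and> card A = w) \<and>
     (\<forall>A. antichain_on V r A \<longrightarrow> finite A \<and> card A \<le> w)"

definition finite_width :: "'a set \<Rightarrow> 'a rel \<Rightarrow> bool" where
  "finite_width V r \<longleftrightarrow> (\<exists>w. has_width V r w)"

text \<open>
  The locale \<open>pred_on\<close> closes its relation reflexively,
  which changes nothing for the reflexive orders considered here.
\<close>

abbreviation chain_on :: "'a set \<Rightarrow> 'a rel \<Rightarrow> 'a set \<Rightarrow> bool" where
  "chain_on V r \<equiv> pred_on.chain V (\<lambda>x y. (x, y) \<in> r)"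

abbreviation maxchain_on :: "'a set \<Rightarrow> 'a rel \<Rightarrow> 'a set \<Rightarrow> bool" where
  "maxchain_on V r \<equiv> pred_on.maxchain V (\<lambda>x y. (x, y) \<in> r)"

end

theory Submission
  imports Defs
begin

text \<open>
  It suffices that every \<open>v\<close> outside \<open>Y\<close> is incomparable to some member of \<open>X\<close>.
  Let \<open>y \<in> Y\<close> be incomparable to \<open>v\<close>, say with \<open>y < v\<close> as reals. Any \<open>x \<in> Y\<close> with
  \<open>y \<le> x < v\<close> is then incomparable to \<open>v\<close> as well, since \<open>x \<preceq> v\<close> would give
  \<open>y \<preceq> x \<preceq> v\<close> and \<open>v \<preceq> x\<close> would give \<open>v \<le> x\<close>. So \<open>X\<close> only has to
  meet \<open>[y, v)\<close>, and dually \<open>(v, y]\<close>, for all \<open>y \<in> Y\<close> and real \<open>v\<close>. This is achieved by taking,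
  for each rational \<open>q\<close>, a countable cofinal subset of \<open>{y \<in> Y. y < q}\<close> and a countable
  coinitial subset of \<open>{y \<in> Y. q < y}\<close>.
\<close>

text \<open>For each rational \<open>p\<close> below some member of \<open>S\<close>, one member
  above \<open>p\<close> is chosen. If \<open>y\<close> is not greatest in \<open>S\<close>, a
  rational between \<open>y\<close> and a larger \<open>s\<close> gives a chosen element above
  \<open>y\<close>. A greatest element may be missed this way, so \<open>?M\<close>, which has at
  most one element, is added.\<close>

lemma countable_cofinal_subset_real:
  fixes S :: "real set"
  obtains C where "countable C" "C \<subseteq> S" "\<And>y. y \<in> S \<Longrightarrow> \<exists>x\<in>C. y \<le> x"
proof
  define above where "above p = (SOME s. s \<in> S \<and> p < s)" for p
  have above: "above p \<in> S \<and> p < above p" if "s \<in> S" "p < s" for p s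
    unfolding above_def by (rule someI[of _ s]) (use that in simp)
  let ?M = "{m \<in> S. \<forall>s\<in>S. s \<le> m}"
  let ?C = "above ` {p \<in> \<rat>. \<exists>s\<in>S. p < s} \<union> ?M"
  have "?M \<subseteq> {m}" if "m \<in> ?M" for m
    using that by (auto intro: antisym)
  then have "finite ?M"
    by (metis (no_types, lifting) ex_in_conv finite.emptyI finite_insert finite_subset)
  then show "countable ?C"
    by (auto intro: countable_finite countable_subset[OF _ countable_rat])
  show "?C \<subseteq> S"
    using above by blast
  show "\<exists>x\<in>?C. y \<le> x" if y: "y \<in> S" for y
  proof (cases "y \<in> ?M")
    case False
    then obtain s where s: "s \<in> S" "y < s"
      using y by force
    then obtain p where "p \<in> \<rat>" "y < p" "p < s"
      using Rats_dense_in_real by blast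
    moreover from this have "y \<le> above p"
      using above s by force
    ultimately show ?thesis
      using s by blast
  qed blast
qed

text \<open>For a rational \<open>q\<close> strictly between \<open>y\<close> and \<open>v\<close>,
  cofinality below \<open>q\<close> gives \<open>x\<close> with
  \<open>y \<le> x < q < v\<close>.\<close>

lemma countable_meets_left_closed_intervals:
  fixes S :: "real set"
  obtains C where "countable C" "C \<subseteq> S"
    "\<And>y v. y \<in> S \<Longrightarrow> y < v \<Longrightarrow> \<exists>x\<in>C. y \<le> x \<and> x < v"
proof -
  have "\<exists>C. countable C \<and> C \<subseteq> {s \<in> S. s < q} \<and> (\<forall>y\<in>{s \<in> S. s < q}. \<exists>x\<in>C. y \<le> x)" for q
    by (rule countable_cofinal_subset_real[of "{s \<in> S. s < q}"]) blast
  then obtain C where C: "countable (C q)" "C q \<subseteq> {s \<in> S. s < q}"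
      "\<forall>y\<in>{s \<in> S. s < q}. \<exists>x\<in>C q. y \<le> x" for q
    by metis
  show thesis
  proof
    show "countable (\<Union>q\<in>\<rat>. C q)"
      using C(1) countable_rat by blast
    show "(\<Union>q\<in>\<rat>. C q) \<subseteq> S"
      using C(2) by blast
    fix y v :: real
    assume "y \<in> S" "y < v"
    then obtain q where "q \<in> \<rat>" "y < q" "q < v"
      using Rats_dense_in_real by blast
    moreover from this obtain x where "x \<in> C q" "y \<le> x"
      using C(3) \<open>y \<in> S\<close> by blast
    ultimately show "\<exists>x\<in>(\<Union>q\<in>\<rat>. C q). y \<le> x \<and> x < v"
      using C(2) by force
  qed
qed

lemma countable_meets_half_open_intervals:
  fixes S :: "real set"
  obtains C where "countable C" "C \<subseteq> S"
    "\<And>y v. y \<in> S \<Longrightarrow> y < v \<Longrightarrow> \<exists>x\<in>C. y \<le> x \<and> x < v"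
    "\<And>y v. y \<in> S \<Longrightarrow> v < y \<Longrightarrow> \<exists>x\<in>C. v < x \<and> x \<le> y"
proof -
  obtain A where A: "countable A" "A \<subseteq> S"
      "\<And>y v. y \<in> S \<Longrightarrow> y < v \<Longrightarrow> \<exists>x\<in>A. y \<le> x \<and> x < v"
    by (rule countable_meets_left_closed_intervals[of S]) blast
  obtain B where B: "countable B" "B \<subseteq> uminus ` S"
      "\<And>y v. y \<in> uminus ` S \<Longrightarrow> y < v \<Longrightarrow> \<exists>x\<in>B. y \<le> x \<and> x < v"
    by (rule countable_meets_left_closed_intervals[of "uminus ` S"]) blast
  show thesis
  proof
    show "countable (A \<union> uminus ` B)" "A \<union> uminus ` B \<subseteq> S"
      using A(1,2) B(1,2) by auto
    show "\<exists>x\<in>A \<union> uminus ` B. y \<le> x \<and> x < v" if "y \<in> S" "y < v" for y v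
      using A(3) that by blast
    show "\<exists>x\<in>A \<union> uminus ` B. v < x \<and> x \<le> y" if yv: "y \<in> S" "v < y" for y v
    proof -
      obtain x where "x \<in> B" "- y \<le> x" "x < - v"
        using B(3)[of "- y" "- v"] yv by auto
      then show ?thesis
        by (intro bexI[of _ "- x"]) auto
    qed
  qed
qed

lemma chain_on_iff:
  assumes "refl_on V r"
  shows "chain_on V r C \<longleftrightarrow> C \<subseteq> V \<and> (\<forall>x\<in>C. \<forall>y\<in>C. (x, y) \<in> r \<or> (y, x) \<in> r)"
  using refl_onD[OF assms] unfolding pred_on.chain_def by blast

lemma maxchain_on_eqI:
  assumes "maxchain_on V r Z" "maxchain_on V r Y" "Z \<subseteq> Y"
  shows "Z = Y"
  using assms unfolding pred_on.maxchain_def by blast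

text \<open>Otherwise adding \<open>v\<close> to \<open>Y\<close> would give a strictly larger
  chain.\<close>

lemma maxchain_on_incomparable:
  assumes refl: "refl_on V r" and Y: "maxchain_on V r Y" and v: "v \<in> V" "v \<notin> Y"
  obtains y where "y \<in> Y" "(y, v) \<notin> r" "(v, y) \<notin> r"
proof -
  have "chain_on V r Y" and "\<not> chain_on V r (insert v Y)"
    using Y v unfolding pred_on.maxchain_def by auto
  then show thesis
    using that v refl_onD[OF refl] unfolding chain_on_iff[OF refl] by blast
qed

theorem theorem3:
  fixes V :: "real set" and r :: "real rel" and Y :: "real set"
  assumes "partial_order_on V r"
    and "finite_width V r"
    and "\<And>x y. x \<in> V \<Longrightarrow> y \<in> V \<Longrightarrow> (x, y) \<in> r \<Longrightarrow> x \<le> y"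
    and "maxchain_on V r Y"
  shows "\<exists>X. chain_on V r X \<and> X \<subseteq> Y \<and> countable X \<and>
             (\<forall>Z. maxchain_on V r Z \<and> X \<subseteq> Z \<longrightarrow> Z = Y)"
proof -
  note le = assms(3)
  have refl: "refl_on V r" and trans: "trans r"
    using assms(1) by (auto simp: partial_order_on_def preorder_on_def)
  have Y: "Y \<subseteq> V" "\<And>x y. x \<in> Y \<Longrightarrow> y \<in> Y \<Longrightarrow> (x, y) \<in> r \<or> (y, x) \<in> r"
    using assms(4) unfolding pred_on.maxchain_def chain_on_iff[OF refl] by blast+
  \<comment> \<open>If \<open>x \<le> y\<close> but the chain only provides
    \<open>(y, x) \<in> r\<close>, then also \<open>y \<le> x\<close>, so
    \<open>x = y\<close>.\<close>
  have r_iff: "(x, y) \<in> r \<longleftrightarrow> x \<le> y" if "x \<in> Y" "y \<in> Y" for x y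
    using Y that le[of x y] le[of y x] by (metis antisym subsetD)
  obtain X where X: "countable X" "X \<subseteq> Y"
      "\<And>y v. y \<in> Y \<Longrightarrow> y < v \<Longrightarrow> \<exists>x\<in>X. y \<le> x \<and> x < v"
      "\<And>y v. y \<in> Y \<Longrightarrow> v < y \<Longrightarrow> \<exists>x\<in>X. v < x \<and> x \<le> y"
    by (rule countable_meets_half_open_intervals[of Y]) blast
  have incomparable: "\<exists>x\<in>X. (x, v) \<notin> r \<and> (v, x) \<notin> r" if v: "v \<in> V" "v \<notin> Y" for v
  proof -
    obtain y where y: "y \<in> Y" "(y, v) \<notin> r" "(v, y) \<notin> r"
      using maxchain_on_incomparable[OF refl assms(4) v] .
    then consider "y < v" | "v < y"
      using v by (metis linorder_neqE)
    then show ?thesis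
    proof cases
      case 1
      then obtain x where x: "x \<in> X" "y \<le> x" "x < v"
        using X(3) y(1) by blast
      then have "x \<in> Y" "(y, x) \<in> r"
        using X(2) r_iff y(1) by auto
      then show ?thesis
        using x v(1) y(2) Y(1) le[of v x] transD[OF trans, of y x v] by force
    next
      case 2
      then obtain x where x: "x \<in> X" "v < x" "x \<le> y"
        using X(4) y(1) by blast
      then have "x \<in> Y" "(x, y) \<in> r"
        using X(2) r_iff y(1) by auto
      then show ?thesis
        using x v(1) y(3) Y(1) le[of x v] transD[OF trans, of v x y] by force
    qed
  qed
  \<comment> \<open>A point of \<open>Z\<close> outside \<open>Y\<close> would be incomparable to
    some member of \<open>X\<close>, hence of \<open>Z\<close>; so \<open>Z \<subseteq> Y\<close>,
    and maximality of \<open>Z\<close> gives equality.\<close>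
  have "Z = Y" if Z: "maxchain_on V r Z" "X \<subseteq> Z" for Z
  proof (rule maxchain_on_eqI[OF Z(1) assms(4)])
    have "Z \<subseteq> V" "\<And>x y. x \<in> Z \<Longrightarrow> y \<in> Z \<Longrightarrow> (x, y) \<in> r \<or> (y, x) \<in> r"
      using Z(1) unfolding pred_on.maxchain_def chain_on_iff[OF refl] by blast+
    then show "Z \<subseteq> Y"
      using incomparable Z(2) by blast
  qed
  moreover have "chain_on V r X"
    using X(2) Y unfolding chain_on_iff[OF refl] by blast
  ultimately show ?thesis
    using X(1,2) by blast
qed

end
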